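(* Let $n\ge 1$ and let $\boldsymbol{Q}\in\mathbb{R}^{n\times n}$ be a nonsingular factorizable matrix defined by sequences $\{u_i\}_{i\in[n]}$, $\{v_i\}_{i\in[n]}$ of real numbers, with $u_i\neq 0$ for all $i\in[n]$. Then the inverse of $\boldsymbol{Q}$ can be expressed as the sum of $n$ rank-one matrices $$\boldsymbol{Q}^{-1}=\sum_{i=1}^n\delta_i\boldsymbol{\gamma}_i\boldsymbol{\gamma}_i^\top,$$ where $$\boldsymbol{\gamma}_i=\boldsymbol{e}_i-\theta_{i+1}\boldsymbol{e}_{i+1},\quad i\in[n-1],\qquad \boldsymbol{\gamma}_n=\boldsymbol{e}_n,$$ $$\delta_i=\frac{u_{i+1}}{u_i(u_{i+1}v_i-u_iv_{i+1})},\quad \theta_{i+1}=\frac{u_i}{u_{i+1}},\quad i\in[n-1],\qquad \delta_n=\frac{1}{u_nv_n}.$$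
   Context: $[n]=\{1,\dots,n\}$ and $\boldsymbol{e}_i$ is the $i$-th standard basis vector of $\mathbb{R}^n$. A symmetric matrix $\boldsymbol{Q}\in\mathbb{R}^{n\times n}$ is factorizable, defined by $\{u_i\}_{i\in[n]}$ and $\{v_i\}_{i\in[n]}$, if $Q_{ij}=Q_{ji}=u_iv_j$ for all $1\le i\le j\le n$. Equivalently, $\boldsymbol{Q}=\boldsymbol{U}\circ\boldsymbol{V}$ (Hadamard product) with $U_{ij}=u_{\min(i,j)}$ and $V_{ij}=v_{\max(i,j)}$. *)

theory Defs
  imports "Jordan_Normal_Form.DL_Rank"
begin

text \<open>
  Matrix and vector positions are 0-based, as in the library, and the sequences \<open>u\<close>, \<open>v\<close> are
  shifted accordingly: the index \<open>i \<in> {1,\<dots>,n}\<close> of the mathematical text is \<open>i - 1 < n\<close> here.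
  So \<open>Suc i < n\<close> corresponds to \<open>i \<in> [n - 1]\<close>, and the last index is \<open>n - 1\<close>.
  Values of \<open>u\<close> and \<open>v\<close> from \<open>n\<close> onwards play no role.
\<close>

definition factorizable_mat :: "nat \<Rightarrow> (nat \<Rightarrow> real) \<Rightarrow> (nat \<Rightarrow> real) \<Rightarrow> real mat \<Rightarrow> bool" where
  "factorizable_mat n u v Q \<longleftrightarrow>
     Q \<in> carrier_mat n n \<and>
     (\<forall>i j. i \<le> j \<and> j < n \<longrightarrow> Q $$ (i, j) = u i * v j \<and> Q $$ (j, i) = u i * v j)"

definition theta :: "(nat \<Rightarrow> real) \<Rightarrow> nat \<Rightarrow> real" where
  "theta u j = u (j - 1) / u j"  \<comment> \<open>only used for \<open>0 < j < n\<close>\<close>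

definition gamma :: "nat \<Rightarrow> (nat \<Rightarrow> real) \<Rightarrow> nat \<Rightarrow> real vec" where
  "gamma n u i =
     (if Suc i < n then unit_vec n i - theta u (Suc i) \<cdot>\<^sub>v unit_vec n (Suc i)
      else unit_vec n i)"

definition delta :: "nat \<Rightarrow> (nat \<Rightarrow> real) \<Rightarrow> (nat \<Rightarrow> real) \<Rightarrow> nat \<Rightarrow> real" where
  "delta n u v i =
     (if Suc i < n then u (Suc i) / (u i * (u (Suc i) * v i - u i * v (Suc i)))
      else 1 / (u i * v i))"

definition self_outer :: "real vec \<Rightarrow> real mat" where
  "self_outer x =
     mat_of_cols (dim_vec x) [x] * transpose_mat (mat_of_cols (dim_vec x) [x])"

text \<open>
  The type class sum is not available for matrices with dimensions as values, so finite sums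
  are taken in the library's module of \<open>n \<times> n\<close> matrices.
\<close>

definition mat_sum :: "nat \<Rightarrow> (nat \<Rightarrow> real mat) \<Rightarrow> nat set \<Rightarrow> real mat" where
  "mat_sum n = finsum (module_mat TYPE(real) n n)"

end

theory Submission
  imports Defs
begin

text \<open>
  Multiplying the factorizable matrix \<open>Q\<close> by \<open>\<gamma>\<^sub>i\<close> cancels every entry below position \<open>i\<close>:
  \<open>Q \<gamma>\<^sub>i = d\<^sub>i (u\<^sub>1, \<dots>, u\<^sub>i, 0, \<dots>, 0)\<^sup>T\<close>, where \<open>\<delta>\<^sub>i = 1 / (u\<^sub>i d\<^sub>i)\<close>. As \<open>Q\<close> is nonsingular and
  \<open>\<gamma>\<^sub>i \<noteq> 0\<close>, no \<open>d\<^sub>i\<close> vanishes. Hence \<open>Q \<Sum>\<^sub>i \<delta>\<^sub>i \<gamma>\<^sub>i \<gamma>\<^sub>i\<^sup>T = \<Sum>\<^sub>i u\<^sub>i\<^sup>-\<^sup>1 (u\<^sub>1, \<dots>, u\<^sub>i, 0, \<dots>, 0)\<^sup>T \<gamma>\<^sub>i\<^sup>T\<close>, whose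
  entry \<open>(j, k)\<close> telescopes to the Kronecker delta.
\<close>

text \<open>The product form bounds the rank by 1 from above. The nonzero entry at
  \<open>(r, c)\<close> makes column \<open>c\<close> a nonzero, hence independent, vector, which
  gives the lower bound.\<close>

lemma (in vec_space) rank_eq_1_product_entries:
  fixes f g :: "nat \<Rightarrow> 'a"
  assumes A: "A \<in> carrier_mat n nc"
    and entries: "\<And>r c. r < n \<Longrightarrow> c < nc \<Longrightarrow> A $$ (r, c) = f r * g c"
    and "r < n" "c < nc" "f r \<noteq> 0" "g c \<noteq> 0"
  shows "rank A = 1"
proof -
  have "rank A \<le> 1"
    by (rule rank_le_1_product_entries[OF A, of f g]) (use A entries in auto)
  moreover have "card {col A c} \<le> rank A"
  proof (rule rank_ge_card_indpt[OF A])
    show "{col A c} \<subseteq> set (cols A)"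
      using A \<open>c < nc\<close> by (auto simp: cols_def)
    have "A $$ (r, c) \<noteq> 0"
      using assms by simp
    then have "col A c \<noteq> 0\<^sub>v n"
      using A \<open>r < n\<close> \<open>c < nc\<close> by (metis carrier_matD index_col index_zero_vec(1))
    moreover have "span {} = {0\<^sub>v n}"
      by (simp add: span_empty)
    moreover have "lin_indpt {}"
      by (simp add: finite_lin_indpt2)
    moreover have "col A c \<in> carrier_vec n"
      using A by auto
    ultimately show "lin_indpt {col A c}"
      using lin_dep_iff_in_span[of "{}" "col A c"] by simp
  qed
  ultimately show ?thesis by simp
qed

text \<open>Both claims go through one induction: reading off an entry of
  \<open>f a + mat_sum n f A\<close> requires the dimensions of the partial sum.\<close>

lemma mat_sum_carrier_index:
  assumes "finite A" "\<And>a. a \<in> A \<Longrightarrow> f a \<in> carrier_mat n n"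
  shows "mat_sum n f A \<in> carrier_mat n n \<and>
    (\<forall>i<n. \<forall>j<n. mat_sum n f A $$ (i, j) = (\<Sum>a\<in>A. f a $$ (i, j)))"
proof -
  interpret M: abelian_group "module_mat TYPE(real) n n"
    by (rule abelian_group_mat)
  show ?thesis
    using assms
  proof (induction A rule: finite_induct)
    case empty
    then show ?case
      by (simp add: mat_sum_def module_mat_simps)
  next
    case (insert a A)
    then have "mat_sum n f (insert a A) = f a + mat_sum n f A"
      using M.finsum_insert[of A a f] by (auto simp: mat_sum_def module_mat_simps)
    with insert show ?case by auto
  qed
qed

lemma gamma_carrier [simp]: "gamma n u i \<in> carrier_vec n"
  by (simp add: gamma_def)

lemma gamma_index:
  assumes "i < n" "k < n"
  shows "gamma n u i $ k =
    (if k = i then 1 else 0) - (if k = Suc i then u i / u k else 0)"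
  using assms by (auto simp: gamma_def theta_def)

lemma self_outer_carrier:
  "x \<in> carrier_vec n \<Longrightarrow> self_outer x \<in> carrier_mat n n"
  by (auto simp: self_outer_def)

lemma self_outer_index:
  assumes "x \<in> carrier_vec n" "i < n" "j < n"
  shows "self_outer x $$ (i, j) = x $ i * x $ j"
  using assms by (auto simp: self_outer_def scalar_prod_def mat_of_cols_index)

text \<open>This is \<open>d\<^sub>i\<close> of the overview; for nonzero \<open>u\<close>, the
  product \<open>u i * pivot n u v i\<close> equals
  \<open>\<gamma>\<^sub>i\<^sup>T Q \<gamma>\<^sub>i\<close>.\<close>

definition pivot :: "nat \<Rightarrow> (nat \<Rightarrow> real) \<Rightarrow> (nat \<Rightarrow> real) \<Rightarrow> nat \<Rightarrow> real" where
  "pivot n u v i = (if Suc i < n then v i - u i / u (Suc i) * v (Suc i) else v i)"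

lemma factorizable_mult_gamma:
  assumes Q: "factorizable_mat n u v Q" and u: "\<forall>i<n. u i \<noteq> 0" and "i < n"
  shows "Q *\<^sub>v gamma n u i = vec n (\<lambda>j. if j \<le> i then u j * pivot n u v i else 0)"
proof (rule eq_vecI)
  have Qc: "Q \<in> carrier_mat n n"
    using Q by (simp add: factorizable_mat_def)
  have Qe: "Q $$ (j, k) = u (min j k) * v (max j k)" if "j < n" "k < n" for j k
    using Q that unfolding factorizable_mat_def by (auto simp: min_def max_def)
  fix j assume "j < dim_vec (vec n (\<lambda>j. if j \<le> i then u j * pivot n u v i else 0))"
  then have j: "j < n" by simp
  show "(Q *\<^sub>v gamma n u i) $ j = vec n (\<lambda>j. if j \<le> i then u j * pivot n u v i else 0) $ j"
  proof (cases "Suc i < n")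
    case True
    have "(Q *\<^sub>v gamma n u i) $ j = Q $$ (j, i) - u i / u (Suc i) * Q $$ (j, Suc i)"
      using Qc True j
      by (simp add: gamma_def theta_def scalar_prod_minus_distrib[of _ n] row_carrier_vec[of _ n])
    \<comment> \<open>For \<open>j \<le> i\<close> the two entries share the factor
      \<open>u j\<close>. For \<open>j > i\<close> they are \<open>u i * v j\<close> and
      \<open>u (Suc i) * v j\<close>, which cancel.\<close>
    then show ?thesis
      using True j u by (cases "j \<le> i") (auto simp: Qe pivot_def min_absorb1 min_absorb2
        max_absorb1 max_absorb2 field_simps)
  next
    case False
    then show ?thesis
      using Q j \<open>i < n\<close> Qe[of j i]
      by (auto simp: factorizable_mat_def gamma_def pivot_def)
  qed
qed (use Q in \<open>auto simp: factorizable_mat_def\<close>)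

lemma pivot_nonzero:
  assumes Q: "factorizable_mat n u v Q" and inv: "invertible_mat Q"
    and u: "\<forall>i<n. u i \<noteq> 0" and i: "i < n"
  shows "pivot n u v i \<noteq> 0"
proof
  assume 0: "pivot n u v i = 0"
  have Qc: "Q \<in> carrier_mat n n"
    using Q by (simp add: factorizable_mat_def)
  obtain B where B: "Q * B = 1\<^sub>m (dim_row Q)" "B * Q = 1\<^sub>m (dim_row B)"
    using inv by (auto simp: invertible_mat_def inverts_mat_def)
  \<comment> \<open>Invertibility does not fix the shape of \<open>B\<close>; it follows from
    comparing column counts in the two identities.\<close>
  have "dim_col B = n"
    using arg_cong[OF B(1), of dim_col] Qc by simp
  moreover have "dim_row B = n"
    using arg_cong[OF B(2), of dim_col] Qc by simp
  ultimately have Bc: "B \<in> carrier_mat n n"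
    by auto
  have "Q *\<^sub>v gamma n u i = 0\<^sub>v n"
    by (intro eq_vecI) (auto simp: factorizable_mult_gamma[OF Q u i] 0)
  then have "gamma n u i = B *\<^sub>v 0\<^sub>v n"
    using B(2) Bc Qc assoc_mult_mat_vec[OF Bc Qc gamma_carrier[of n u i]] by simp
  also have "\<dots> = 0\<^sub>v n"
    using Bc by auto
  finally show False
    using i gamma_index[OF i i, of u] by simp
qed

text \<open>Clear the fraction inside \<open>pivot\<close>. At a zero pivot both sides are 0, by the
  convention for division.\<close>

lemma delta_eq_inverse_pivot:
  assumes "\<forall>i<n. u i \<noteq> 0"
  shows "i < n \<Longrightarrow> delta n u v i = 1 / (u i * pivot n u v i)"
  using assms by (auto simp: delta_def pivot_def field_simps)

text \<open>Only \<open>i = k\<close> and \<open>i = k - 1\<close> contribute: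
  \<open>u j / u k\<close> if \<open>j \<le> k\<close>, minus the same value if
  \<open>j < k\<close>. The difference survives only for \<open>j = k\<close>.\<close>

lemma telescoping_sum:
  assumes u: "\<forall>i<n. u i \<noteq> 0" and "j < n" "k < n"
  shows "(\<Sum>i<n. (if j \<le> i then u j / u i else 0) * gamma n u i $ k) = (if j = k then 1 else 0)"
proof -
  let ?w = "\<lambda>i. if j \<le> i then u j / u i else 0"
  have "(\<Sum>i<n. ?w i * gamma n u i $ k) =
    (\<Sum>i<n. (if i = k then ?w i else 0)) - (\<Sum>i<n. (if k = Suc i then ?w i * u i / u k else 0))"
    unfolding sum_subtractf[symmetric]
    using \<open>k < n\<close> by (intro sum.cong) (auto simp: gamma_index)
  also have "(\<Sum>i<n. (if k = Suc i then ?w i * u i / u k else 0)) = (if j < k then u j / u k else 0)"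
  \<comment> \<open>For \<open>k = 0\<close> there is no predecessor index and the sum
    vanishes.\<close>
  proof (cases k)
    case (Suc m)
    then show ?thesis
      using u \<open>k < n\<close> by auto
  qed simp
  finally show ?thesis
    using u \<open>j < n\<close> \<open>k < n\<close> by auto
qed

theorem proposition3:
  fixes n :: nat and u v :: "nat \<Rightarrow> real" and Q :: "real mat"
  assumes "n \<ge> 1"
    and "factorizable_mat n u v Q"
    and "invertible_mat Q"
    and "\<forall>i<n. u i \<noteq> 0"
  defines "R \<equiv> (\<lambda>i. delta n u v i \<cdot>\<^sub>m self_outer (gamma n u i))"
  shows "(\<forall>i. Suc i < n \<longrightarrow> u i * (u (Suc i) * v i - u i * v (Suc i)) \<noteq> 0)
       \<and> u (n - 1) * v (n - 1) \<noteq> 0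
       \<and> (\<forall>i<n. vec_space.rank n (R i) = 1)
       \<and> inverts_mat Q (mat_sum n R {0..<n})
       \<and> inverts_mat (mat_sum n R {0..<n}) Q"
proof -
  note Q = assms(2) and u = assms(4)
  note pivot = pivot_nonzero[OF Q assms(3) u]
  have Qc: "Q \<in> carrier_mat n n"
    using Q by (simp add: factorizable_mat_def)
  have Rc: "R i \<in> carrier_mat n n" for i
    by (simp add: R_def self_outer_carrier)
  have Re: "R i $$ (r, c) = delta n u v i * gamma n u i $ r * gamma n u i $ c"
    if "r < n" "c < n" for i r c
    using that self_outer_carrier[OF gamma_carrier, of n u i]
    by (simp add: R_def self_outer_index[OF gamma_carrier])
  let ?S = "mat_sum n R {0..<n}"
  have Sc: "?S \<in> carrier_mat n n"
    using mat_sum_carrier_index[of "{0..<n}" R n] Rc by simp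
  have Se: "?S $$ (r, c) = (\<Sum>i<n. R i $$ (r, c))" if "r < n" "c < n" for r c
    using mat_sum_carrier_index[of "{0..<n}" R n] Rc that by (auto simp: atLeast0LessThan)
  \<comment> \<open>The bracket is \<open>u (Suc i) * pivot n u v i\<close>.\<close>
  have nonzero1: "u i * (u (Suc i) * v i - u i * v (Suc i)) \<noteq> 0" if "Suc i < n" for i
    using pivot[of i] u that by (auto simp: pivot_def field_simps)
  have nonzero2: "u (n - 1) * v (n - 1) \<noteq> 0"
    using pivot[of "n - 1"] u \<open>n \<ge> 1\<close> by (auto simp: pivot_def)
  have rank: "vec_space.rank n (R i) = 1" if i: "i < n" for i
  \<comment> \<open>The witness is the diagonal entry \<open>(i, i)\<close>: there
    \<open>gamma n u i\<close> is 1, so the entry is the nonzero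
    \<open>delta n u v i\<close>.\<close>
  proof (rule vec_space.rank_eq_1_product_entries[OF Rc _ i i])
    show "R i $$ (r, c) = (delta n u v i * gamma n u i $ r) * gamma n u i $ c"
      if "r < n" "c < n" for r c
      by (rule Re[OF that])
    show "delta n u v i * gamma n u i $ i \<noteq> 0" "gamma n u i $ i \<noteq> 0"
      using i u pivot[OF i] by (auto simp: delta_eq_inverse_pivot[OF u i] gamma_index)
  qed
  have QS: "Q * ?S = 1\<^sub>m n"
  proof (rule eq_matI)
    fix j k assume "j < dim_row (1\<^sub>m n)" "k < dim_col (1\<^sub>m n)"
    then have j: "j < n" and k: "k < n" by auto
    have Qg: "(\<Sum>l<n. Q $$ (j, l) * gamma n u i $ l) = (Q *\<^sub>v gamma n u i) $ j" for i
      using Qc j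
      by (simp add: scalar_prod_def atLeast0LessThan carrier_vecD[OF gamma_carrier])
    have "(Q * ?S) $$ (j, k) = (\<Sum>l<n. Q $$ (j, l) * ?S $$ (l, k))"
      using Qc Sc j k by (simp add: scalar_prod_def atLeast0LessThan)
    also have "\<dots> = (\<Sum>l<n. \<Sum>i<n. Q $$ (j, l) * R i $$ (l, k))"
      using k by (simp add: Se sum_distrib_left)
    \<comment> \<open>With \<open>l\<close> innermost, the inner sum collects into an entry of
      \<open>Q *\<^sub>v gamma n u i\<close>.\<close>
    also have "\<dots> = (\<Sum>i<n. \<Sum>l<n. Q $$ (j, l) * R i $$ (l, k))"
      by (rule sum.swap)
    also have "\<dots> = (\<Sum>i<n. delta n u v i * (Q *\<^sub>v gamma n u i) $ j * gamma n u i $ k)"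
      using k by (simp add: Re Qg[symmetric] sum_distrib_left sum_distrib_right mult_ac)
    \<comment> \<open>The nonzero pivot cancels against the one in \<open>delta\<close>, leaving
      \<open>u j / u i\<close>.\<close>
    also have "\<dots> = (\<Sum>i<n. (if j \<le> i then u j / u i else 0) * gamma n u i $ k)"
      using j pivot
      by (intro sum.cong) (auto simp: factorizable_mult_gamma[OF Q u] delta_eq_inverse_pivot[OF u])
    also have "\<dots> = 1\<^sub>m n $$ (j, k)"
      using j k by (simp add: telescoping_sum[OF u j k])
    finally show "(Q * ?S) $$ (j, k) = 1\<^sub>m n $$ (j, k)" .
  qed (use Qc Sc in auto)
  \<comment> \<open>For square matrices over a field, a right inverse is also a left
    inverse.\<close>
  have "?S * Q = 1\<^sub>m n"
    by (rule mat_mult_left_right_inverse[OF Qc Sc QS])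
  with QS Qc Sc nonzero1 nonzero2 rank show ?thesis
    by (simp add: inverts_mat_def)
qed

end
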